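(* Let $d$ be either $0$ or a positive square-free integer, $K=\mathbb{Q}(\sqrt{-d})$, $R$ the ring of integers of $K$, and let $n\geq1$ be an integer. (a) The graph $\Gamma_{1,n}$ is planar if and only if $n=1$. (b) The graph $\Gamma^{un}_{2,n}$ is planar if and only if $n=1$.
   Context: The zero-divisor graph $\Gamma(M_2(R))$ is the directed graph whose vertices are the nonzero (left or right) zero-divisors of $M_2(R)$, with an edge $v_1\to v_2$ between distinct vertices iff $v_1v_2=0$. For an integer $N\geq1$ and $t\in R$, let $S_{tc,1,t,N}=\{\lambda\begin{bmatrix}1&t\\t^2&t^3\end{bmatrix}:\lambda\in\mathbb{Z},\,1\leq|\lambda|\leq N\}$ and $S_{tc,2,N}=\{\begin{bmatrix}0&0\\0&\lambda\end{bmatrix}:\lambda\in\mathbb{Z},\,1\leq|\lambda|\leq N\}$. Let $\Gamma_{1,N}$ be the induced subgraph of $\Gamma(M_2(R))$ on $S_{tc,1,0,N}\cup S_{tc,2,N}$, regarded as an undirected graph. Let $U=\{\pm1\}$ if $d\neq1,3$, $U=\{\pm1,\pm i\}$ if $d=1$ ($i=\sqrt{-1}$), $U=\{\pm1,\pm\omega,\pm\omega^2\}$ if $d=3$ ($\omega$ a primitive third root of unity); let $\Gamma_{2,N}$ be the induced subgraph of $\Gamma(M_2(R))$ on $\bigcup_{j\in U}S_{tc,1,j,N}$, and $\Gamma^{un}_{2,N}$ its underlying undirected graph (distinct $v_1,v_2$ adjacent iff $v_1v_2=0$ or $v_2v_1=0$). *)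

theory Defs
  imports
    "Graph_Theory.Digraph_Component"
    "HOL-Computational_Algebra.Squarefree"
    "HOL-Analysis.Analysis"
begin

definition is_subfield :: "'a::field set \<Rightarrow> bool" where
  "is_subfield F \<longleftrightarrow> 0 \<in> F \<and> 1 \<in> F \<and>
     (\<forall>x\<in>F. \<forall>y\<in>F. x + y \<in> F \<and> x * y \<in> F) \<and> (\<forall>x\<in>F. - x \<in> F \<and> inverse x \<in> F)"

definition quadratic_field :: "nat \<Rightarrow> complex set" where
  "quadratic_field d = \<Inter>{F. is_subfield F \<and> csqrt (- of_nat d) \<in> F}"

definition ring_of_ints :: "nat \<Rightarrow> complex set" where
  "ring_of_ints d = {x \<in> quadratic_field d. algebraic_int x}"

definition matrices_over :: "'a set \<Rightarrow> ('a^2^2) set" where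
  "matrices_over R = {A. \<forall>i j. A $ i $ j \<in> R}"

definition is_zero_divisor_in :: "('a::semiring_1^2^2) set \<Rightarrow> 'a^2^2 \<Rightarrow> bool" where
  "is_zero_divisor_in M A \<longleftrightarrow> A \<in> M \<and> (\<exists>B\<in>M. B \<noteq> 0 \<and> (A ** B = 0 \<or> B ** A = 0))"

definition zero_divisor_graph :: "('a::semiring_1) set \<Rightarrow> ('a^2^2) pair_pre_digraph" where
  "zero_divisor_graph R =
     (let V = {A. A \<noteq> 0 \<and> is_zero_divisor_in (matrices_over R) A}
      in \<lparr> pverts = V, parcs = {(A, B). A \<in> V \<and> B \<in> V \<and> A \<noteq> B \<and> A ** B = 0} \<rparr>)"

definition mat2 :: "'a::zero \<Rightarrow> 'a \<Rightarrow> 'a \<Rightarrow> 'a \<Rightarrow> 'a^2^2" where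
  "mat2 a b c e = vector [vector [a, b], vector [c, e]]"

definition S_tc1 :: "complex \<Rightarrow> nat \<Rightarrow> (complex^2^2) set" where
  "S_tc1 t N = {of_int l *\<^sub>R mat2 1 t (t^2) (t^3) | l::int. 1 \<le> \<bar>l\<bar> \<and> \<bar>l\<bar> \<le> int N}"

definition S_tc2 :: "nat \<Rightarrow> (complex^2^2) set" where
  "S_tc2 N = {mat2 0 0 0 (of_int l) | l::int. 1 \<le> \<bar>l\<bar> \<and> \<bar>l\<bar> \<le> int N}"

text \<open>The set does not depend on which of the two primitive third roots of unity is taken.\<close>

definition U_set :: "nat \<Rightarrow> complex set" where
  "U_set d =
     (if d = 1 then {1, -1, \<i>, -\<i>}
      else if d = 3 then
        (let \<omega> = cis (2 * pi / 3) in {1, -1, \<omega>, -\<omega>, \<omega>^2, -(\<omega>^2)})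
      else {1, -1})"

definition Gamma1 :: "nat \<Rightarrow> nat \<Rightarrow> (complex^2^2) pair_pre_digraph" where
  "Gamma1 d N =
     mk_symmetric (with_proj (zero_divisor_graph (ring_of_ints d)) \<restriction> (S_tc1 0 N \<union> S_tc2 N))"

definition Gamma2 :: "nat \<Rightarrow> nat \<Rightarrow> (complex^2^2, (complex^2^2) \<times> (complex^2^2)) pre_digraph" where
  "Gamma2 d N =
     with_proj (zero_divisor_graph (ring_of_ints d)) \<restriction> (\<Union>j\<in>U_set d. S_tc1 j N)"

definition Gamma2_un :: "nat \<Rightarrow> nat \<Rightarrow> (complex^2^2) pair_pre_digraph" where
  "Gamma2_un d N = mk_symmetric (Gamma2 d N)"

text \<open>The library's induced subgraph takes its vertex set as given; the next lemmas record that the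
  sets used above do consist of vertices of the zero-divisor graph.\<close>

lemma quadratic_field_subfield: "is_subfield (quadratic_field d)"
  unfolding quadratic_field_def is_subfield_def by blast

lemma quadratic_field_of_int: "of_int k \<in> quadratic_field d"
proof -
  have sf: "is_subfield (quadratic_field d)" by (rule quadratic_field_subfield)
  have nat: "of_nat m \<in> quadratic_field d" for m
    using sf by (induction m) (auto simp: is_subfield_def)
  show ?thesis
    using nat sf by (cases k rule: int_cases2) (auto simp: is_subfield_def)
qed

lemma mult_power_root_of_unity_in_ring_of_ints:
  assumes "t \<in> quadratic_field d" "t ^ 6 = 1 \<or> t ^ 4 = 1 \<or> t = 0"
  shows "of_int k * t ^ m \<in> ring_of_ints d"
proof -
  have sf: "is_subfield (quadratic_field d)" by (rule quadratic_field_subfield)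
  have pw: "t ^ m \<in> quadratic_field d" for m
    using sf assms(1) by (induction m) (auto simp: is_subfield_def)
  have K: "of_int k * t ^ m \<in> quadratic_field d"
    using sf pw quadratic_field_of_int by (auto simp: is_subfield_def)
  have t12: "t ^ 12 = 1 \<or> t = 0"
  proof -
    have "t ^ 12 = (t ^ 6) ^ 2" "t ^ 12 = (t ^ 4) ^ 3" by (simp_all flip: power_mult)
    then show ?thesis using assms(2) by (metis power_one)
  qed
  define x where "x = of_int k * t ^ m"
  have "x ^ 12 = of_int (k ^ 12) * (t ^ 12) ^ m"
    by (simp add: x_def power_mult_distrib mult.commute flip: power_mult)
  moreover have "(t ^ 12) ^ m = of_int 1 \<or> (t ^ 12) ^ m = of_int 0"
    using t12 by (cases "m = 0") auto
  ultimately have "\<exists>c::int. x ^ 12 = of_int c"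
    by (metis of_int_mult)
  then obtain c :: int where c: "x ^ 12 = of_int c" by blast
  define q :: "complex poly" where "q = monom 1 12 + [:- of_int c:]"
  have "degree q = 12"
    unfolding q_def by (subst degree_add_eq_left) (auto simp: degree_monom_eq)
  then have "lead_coeff q = 1"
    by (simp add: q_def coeff_pCons split: nat.splits)
  moreover have "\<forall>i. coeff q i \<in> \<int>"
    by (auto simp: q_def coeff_pCons split: nat.splits)
  moreover have "poly q x = 0"
    using c by (simp add: q_def poly_monom)
  ultimately have "algebraic_int x" by (rule algebraic_int.intros)
  with K show ?thesis by (simp add: ring_of_ints_def x_def)
qed

lemma U_set_props:
  assumes "t \<in> U_set d"
  shows "t \<in> quadratic_field d" "t ^ 6 = 1 \<or> t ^ 4 = 1 \<or> t = 0"
proof -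
  let ?K = "quadratic_field d"
  have sf: "is_subfield ?K" by (rule quadratic_field_subfield)
  have neg: "- x \<in> ?K" if "x \<in> ?K" for x using sf that by (auto simp: is_subfield_def)
  have mult: "x * y \<in> ?K" if "x \<in> ?K" "y \<in> ?K" for x y using sf that by (auto simp: is_subfield_def)
  have one: "1 \<in> ?K" using sf by (auto simp: is_subfield_def)
  have sq: "csqrt (- of_nat d) \<in> ?K" by (auto simp: quadratic_field_def)
  let ?w = "cis (2 * pi / 3)"
  have w3: "?w ^ 3 = 1" by (simp add: Complex.DeMoivre)
  then have w6: "?w ^ 6 = 1" "(?w ^ 2) ^ 6 = 1"
    using power_mult[of ?w 3 2] power_mult[of ?w 3 4] by (simp_all flip: power_mult)
  have i: "\<i> \<in> ?K" if "d = 1" using sq that by simp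
  have w: "?w \<in> ?K" if "d = 3"
  proof -
    have "csqrt (- of_nat 3) = \<i> * of_real (sqrt 3)"
      by (rule csqrt_unique) (auto simp: power_mult_distrib simp flip: of_real_power)
    moreover have "?w = (- 1 + \<i> * of_real (sqrt 3)) * inverse (of_int 2)"
      by (auto simp: complex_eq_iff cos_120 sin_120)
    moreover have "inverse (of_int 2) \<in> ?K"
      using sf quadratic_field_of_int[of 2 d] unfolding is_subfield_def by blast
    moreover have "- 1 + csqrt (- of_nat d) \<in> ?K"
      using sf sq neg[OF one] unfolding is_subfield_def by blast
    ultimately show ?thesis using that mult by metis
  qed
  show "t \<in> ?K"
    using assms i w one neg mult
    by (auto simp: U_set_def Let_def power2_eq_square split: if_splits)
  show "t ^ 6 = 1 \<or> t ^ 4 = 1 \<or> t = 0"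
    using assms w6 by (auto simp: U_set_def Let_def split: if_splits)
qed

lemma mat2_nth [simp]:
  "mat2 a b c e $ 1 $ 1 = a" "mat2 a b c e $ 1 $ 2 = b"
  "mat2 a b c e $ 2 $ 1 = c" "mat2 a b c e $ 2 $ 2 = e"
  by (simp_all add: mat2_def)

lemma S_tc1_subset_verts:
  assumes "t \<in> quadratic_field d" "t ^ 6 = 1 \<or> t ^ 4 = 1 \<or> t = 0"
  shows "S_tc1 t N \<subseteq> pverts (zero_divisor_graph (ring_of_ints d))"
proof
  fix A assume "A \<in> S_tc1 t N"
  then obtain l :: int where "1 \<le> \<bar>l\<bar>" and A: "A = of_int l *\<^sub>R mat2 1 t (t^2) (t^3)"
    unfolding S_tc1_def by blast
  then have l: "l \<noteq> 0" "A = of_int l *\<^sub>R mat2 1 t (t^2) (t^3)" by auto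
  have E: "(real_of_int l *\<^sub>R M) $ i $ j = complex_of_int l * M $ i $ j" for M :: "complex^2^2" and i j
    by (simp add: scaleR_conv_of_real[where 'a = complex])
  note R = mult_power_root_of_unity_in_ring_of_ints[OF assms]
  have "A $ i $ j \<in> ring_of_ints d" for i j
    using R[of l 0] R[of l 1] R[of l 2] R[of l 3] exhaust_2[of i] exhaust_2[of j]
    by (auto simp: l E simp del: vector_scaleR_component)
  moreover have "A \<noteq> 0" using l by (auto simp: vec_eq_iff forall_2)
  moreover let ?B = "mat2 t 0 (-1) 0 :: complex^2^2"
  have "?B $ i $ j \<in> ring_of_ints d" for i j
    using R[of 1 1] R[of 0 0] R[of "-1" 0] exhaust_2[of i] exhaust_2[of j] by auto
  moreover have "?B \<noteq> 0" by (auto simp: vec_eq_iff forall_2)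
  moreover have "A ** ?B = 0"
    by (auto simp: l vec_eq_iff forall_2 matrix_matrix_mult_def sum_2 power2_eq_square
        power3_eq_cube E simp del: vector_scaleR_component)
  ultimately show "A \<in> pverts (zero_divisor_graph (ring_of_ints d))"
    by (auto simp: zero_divisor_graph_def Let_def is_zero_divisor_in_def matrices_over_def)
qed

lemma S_tc2_subset_verts: "S_tc2 N \<subseteq> pverts (zero_divisor_graph (ring_of_ints d))"
proof
  fix A assume "A \<in> S_tc2 N"
  then obtain l :: int where "1 \<le> \<bar>l\<bar>" and A: "A = mat2 0 0 0 (of_int l)"
    unfolding S_tc2_def by blast
  then have l: "l \<noteq> 0" "A = mat2 0 0 0 (of_int l)" by auto
  have R: "of_int k \<in> ring_of_ints d" for k
    using mult_power_root_of_unity_in_ring_of_ints[of 0 d k 0] quadratic_field_of_int[of 0 d] by simp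
  have "A $ i $ j \<in> ring_of_ints d" for i j
    using R[of l] R[of 0] exhaust_2[of i] exhaust_2[of j] by (auto simp: l)
  moreover have "A \<noteq> 0" using l by (auto simp: vec_eq_iff forall_2)
  moreover let ?B = "mat2 1 0 0 0 :: complex^2^2"
  have "?B $ i $ j \<in> ring_of_ints d" for i j
    using R[of 1] R[of 0] exhaust_2[of i] exhaust_2[of j] by auto
  moreover have "?B \<noteq> 0" by (auto simp: vec_eq_iff forall_2)
  moreover have "A ** ?B = 0"
    by (auto simp: l vec_eq_iff forall_2 matrix_matrix_mult_def sum_2)
  ultimately show "A \<in> pverts (zero_divisor_graph (ring_of_ints d))"
    by (auto simp: zero_divisor_graph_def Let_def is_zero_divisor_in_def matrices_over_def)
qed

lemma Gamma_verts_subset: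
  "S_tc1 0 N \<union> S_tc2 N \<subseteq> pverts (zero_divisor_graph (ring_of_ints d))"
  "(\<Union>j\<in>U_set d. S_tc1 j N) \<subseteq> pverts (zero_divisor_graph (ring_of_ints d))"
  using S_tc1_subset_verts[of 0 d N] quadratic_field_of_int[of 0 d] S_tc2_subset_verts
    S_tc1_subset_verts U_set_props by (simp, blast)

definition uedges :: "'a pair_pre_digraph \<Rightarrow> 'a set set" where
  "uedges G = {{u, v} | u v. (u, v) \<in> parcs G}"

text \<open>A drawing of a loop-free symmetric digraph, viewed as a simple graph whose edges are the
  two-element sets of adjacent vertices: vertices go to distinct points of the plane, an edge goes
  to a simple arc joining its two ends and passing through no other vertex, and two distinct edges
  meet at most in the images of their common ends.\<close>

definition planar_drawing ::
    "'a pair_pre_digraph \<Rightarrow> ('a \<Rightarrow> complex) \<Rightarrow> ('a set \<Rightarrow> real \<Rightarrow> complex) \<Rightarrow> bool" where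
  "planar_drawing G p g \<longleftrightarrow>
     inj_on p (pverts G) \<and>
     (\<forall>e\<in>uedges G. arc (g e) \<and> {pathstart (g e), pathfinish (g e)} = p ` e \<and>
        path_image (g e) \<inter> p ` pverts G = p ` e) \<and>
     (\<forall>e\<in>uedges G. \<forall>f\<in>uedges G. e \<noteq> f \<longrightarrow>
        path_image (g e) \<inter> path_image (g f) \<subseteq> p ` (e \<inter> f))"

definition planar :: "'a pair_pre_digraph \<Rightarrow> bool" where
  "planar G \<longleftrightarrow> (\<exists>p g. planar_drawing G p g)"

end

theory Submission
  imports Defs
begin

text \<open>For \<open>n \<ge> 2\<close> both graphs contain a \<open>K\<^sub>3\<^sub>,\<^sub>3\<close>, on multiples of \<open>E\<^sub>1\<^sub>1\<close> and \<open>E\<^sub>2\<^sub>2\<close> in the first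
  graph and on multiples of \<open>M\<^sub>-\<^sub>1\<close> and \<open>M\<^sub>1\<close> in the second, where \<open>M\<^sub>t\<close> is the matrix with rows
  \<open>(1, t)\<close> and \<open>(t\<^sup>2, t\<^sup>3)\<close>. In a drawing of \<open>K\<^sub>3\<^sub>,\<^sub>3\<close>, two vertices of one part together with the other
  part span a theta curve. The third vertex lies in a face of the theta curve, and this face has all
  three arcs of the curve on its frontier; but a face of a theta curve meets only two of the arcs.

  For \<open>n = 1\<close>, since \<open>M\<^sub>t M\<^sub>u = 0\<close> iff \<open>1 + t u\<^sup>2 = 0\<close>, the second graph is \<open>K\<^sub>4\<close> minus an edge, three
  copies of it (\<open>d = 3\<close>), or \<open>K\<^sub>2\<^sub>,\<^sub>6\<close> plus one edge (\<open>d = 1\<close>), and the first is \<open>K\<^sub>2\<^sub>,\<^sub>2\<close>. All are drawn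
  with straight lines, the independent vertices of high degree being poles above and below the real
  axis.\<close>

section \<open>Faces of theta curves\<close>

definition theta_curve ::
    "complex \<Rightarrow> complex \<Rightarrow> (real \<Rightarrow> complex) \<Rightarrow> (real \<Rightarrow> complex) \<Rightarrow> (real \<Rightarrow> complex) \<Rightarrow> bool" where
  "theta_curve a b c1 c2 c3 \<longleftrightarrow> a \<noteq> b \<and>
     (\<forall>c\<in>{c1, c2, c3}. arc c \<and> pathstart c = a \<and> pathfinish c = b) \<and>
     path_image c1 \<inter> path_image c2 = {a, b} \<and>
     path_image c1 \<inter> path_image c3 = {a, b} \<and>
     path_image c2 \<inter> path_image c3 = {a, b}"

lemma theta_curve_rotate: "theta_curve a b c1 c2 c3 \<Longrightarrow> theta_curve a b c2 c3 c1"
  and theta_curve_swap: "theta_curve a b c1 c2 c3 \<Longrightarrow> theta_curve a b c2 c1 c3"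
  by (auto simp: theta_curve_def)

text \<open>\<open>c1\<close> followed by the reverse of \<open>c2\<close> is a simple closed curve,
  so the Jordan curve theorem applies to its image.\<close>

lemma theta_curve_Jordan:
  assumes "theta_curve a b c1 c2 c3"
  defines "C \<equiv> path_image c1 \<union> path_image c2"
  shows "inside C \<noteq> {}" "Topological_Spaces.connected (inside C)"
    "Topological_Spaces.connected (outside C)" "frontier (inside C) = C" "compact C"
proof -
  let ?c = "c1 +++ reversepath c2"
  have c: "arc c1" "arc c2" "pathstart c1 = a" "pathfinish c1 = b" "pathstart c2 = a"
    "pathfinish c2 = b" "path_image c1 \<inter> path_image c2 = {a, b}"
    using assms by (auto simp: theta_curve_def)
  have "simple_path ?c"
    using c by (intro simple_path_join_loop) (auto simp: arc_reversepath)
  moreover have "pathfinish ?c = pathstart ?c" "path_image ?c = C"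
    using c by (simp_all add: C_def path_image_join)
  ultimately show "inside C \<noteq> {}" "Topological_Spaces.connected (inside C)"
    "Topological_Spaces.connected (outside C)" "frontier (inside C) = C"
    using Jordan_inside_outside[of ?c] by auto
  show "compact C"
    unfolding C_def using c by (intro compact_Un compact_arc_image)
qed

text \<open>An arc stays connected when its two ends are removed, and these ends are its only points
  on the other two arcs.\<close>

lemma theta_curve_endless:
  assumes "theta_curve a b c1 c2 c3"
  defines "D \<equiv> path_image c3 - {a, b}"
  shows "D \<noteq> {}" "Topological_Spaces.connected D" "D \<inter> (path_image c1 \<union> path_image c2) = {}"
proof -
  have c: "simple_path c3" "D = path_image c3 - {pathstart c3, pathfinish c3}"
    using assms by (auto simp: theta_curve_def arc_imp_simple_path)
  show "D \<noteq> {}" "Topological_Spaces.connected D"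
    using nonempty_simple_path_endless[OF c(1)] connected_simple_path_endless[OF c(1)]
    by (simp_all add: c(2))
  show "D \<inter> (path_image c1 \<union> path_image c2) = {}"
    using assms by (auto simp: theta_curve_def)
qed

lemma connected_subset_inside_or_outside:
  assumes "Topological_Spaces.connected S" "S \<inter> T = {}"
  shows "S \<subseteq> inside T \<or> S \<subseteq> outside T"
  using inside_outside_intersect_connected[OF assms(1), of T] assms(2) inside_Un_outside[of T]
  by blast

text \<open>Suppose that no arc enters the inside of the cycle formed by the other two. A point
  \<open>x\<close> inside the cycle of \<open>c1\<close> and \<open>c2\<close> is then outside the
  other two cycles, so neither of these separates it from a point \<open>y\<close> outside the whole
  curve. They meet in the connected arc \<open>c3\<close>, so by Janiszewski's theorem their union
  does not separate \<open>x\<close> from \<open>y\<close> either. But this union contains the first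
  cycle, which does.\<close>

lemma theta_curve_arc_inside:
  assumes "theta_curve a b c1 c2 c3"
  shows "path_image c3 \<inter> inside (path_image c1 \<union> path_image c2) \<noteq> {} \<or>
         path_image c2 \<inter> inside (path_image c1 \<union> path_image c3) \<noteq> {} \<or>
         path_image c1 \<inter> inside (path_image c2 \<union> path_image c3) \<noteq> {}"
proof (rule ccontr)
  let ?P1 = "path_image c1" and ?P2 = "path_image c2" and ?P3 = "path_image c3"
  assume *: "\<not> ?thesis"
  note th = assms theta_curve_swap[OF assms] theta_curve_rotate[OF assms]
    theta_curve_swap[OF theta_curve_rotate[OF assms]] theta_curve_rotate[OF theta_curve_rotate[OF assms]]
    theta_curve_rotate[OF theta_curve_swap[OF assms]]
  note J12 = theta_curve_Jordan[OF th(1)] and J23 = theta_curve_Jordan[OF th(3)]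
    and J13 = theta_curve_Jordan[OF th(6)]
  obtain x where x: "x \<in> inside (?P1 \<union> ?P2)" using J12(1) by blast
  \<comment> \<open>\<open>P\<close> and \<open>Q\<close> stand for \<open>?P1\<close> and
    \<open>?P2\<close> in either order. Otherwise the insides of the two cycles, each connected and
    disjoint from the other cycle, would coincide, and so would their frontiers, the cycles
    themselves.\<close>
  have xo: "x \<in> outside (P \<union> ?P3)"
    if P: "P \<union> Q = ?P1 \<union> ?P2" "Q - P - ?P3 \<noteq> {}"
       "Topological_Spaces.connected (inside (P \<union> ?P3))"
       "inside (P \<union> ?P3) \<inter> Q = {}" "frontier (inside (P \<union> ?P3)) = P \<union> ?P3" for P Q
  proof (rule ccontr)
    assume n: "x \<notin> outside (P \<union> ?P3)"
    have 1: "inside (?P1 \<union> ?P2) \<inter> (P \<union> ?P3) = {}"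
      using * P(1) inside_no_overlap[of "?P1 \<union> ?P2"] by blast
    have 2: "inside (P \<union> ?P3) \<inter> (?P1 \<union> ?P2) = {}"
      using P(1,4) inside_no_overlap[of "P \<union> ?P3"] by blast
    have "inside (?P1 \<union> ?P2) \<subseteq> inside (P \<union> ?P3)"
      using connected_subset_inside_or_outside[OF J12(2) 1] x n by blast
    moreover have "inside (P \<union> ?P3) \<subseteq> inside (?P1 \<union> ?P2)"
      using connected_subset_inside_or_outside[OF P(3) 2] x calculation
        inside_Int_outside[of "?P1 \<union> ?P2"] by blast
    ultimately have "P \<union> ?P3 = ?P1 \<union> ?P2"
      using P(5) J12(4) by simp
    then show False using P(1,2) by blast
  qed
  have xo: "x \<in> outside (?P1 \<union> ?P3)" "x \<in> outside (?P2 \<union> ?P3)"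
  proof -
    have "?P2 - ?P1 - ?P3 \<noteq> {}" "?P1 - ?P2 - ?P3 \<noteq> {}"
      using theta_curve_endless[OF th(5)] theta_curve_endless[OF th(3)] by blast+
    then show "x \<in> outside (?P1 \<union> ?P3)" "x \<in> outside (?P2 \<union> ?P3)"
      using * J13(2,4) J23(2,4)
      by (intro xo[of ?P1 ?P2] xo[of ?P2 ?P1]; simp add: Un_commute Int_commute)+
  qed
  have "bounded (?P1 \<union> ?P2 \<union> ?P3)"
    using J12(5) J13(5) by (metis bounded_Un compact_imp_bounded)
  then have "\<not> bounded (outside (?P1 \<union> ?P2 \<union> ?P3))" by (rule unbounded_outside)
  then obtain y where y: "y \<in> outside (?P1 \<union> ?P2 \<union> ?P3)" by (metis bounded_empty ex_in_conv)
  have yo: "y \<in> outside (?P1 \<union> ?P3)" "y \<in> outside (?P2 \<union> ?P3)" "y \<in> outside (?P1 \<union> ?P2)"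
    using y outside_mono by (metis Un_upper1 Un_commute Un_assoc subsetD)+
  have con: "connected_component (- S) x y"
    if "Topological_Spaces.connected (outside S)" "x \<in> outside S" "y \<in> outside S" for S
    using that outside_no_overlap[of S] unfolding connected_component_def by blast
  have "Topological_Spaces.connected ((?P1 \<union> ?P3) \<inter> (?P2 \<union> ?P3))"
  proof -
    have "(?P1 \<union> ?P3) \<inter> (?P2 \<union> ?P3) = ?P3" "arc c3"
      using assms pathstart_in_path_image[of c3] pathfinish_in_path_image[of c3]
      by (auto simp: theta_curve_def)
    then show ?thesis by (simp add: connected_arc_image)
  qed
  then have "connected_component (- ((?P1 \<union> ?P3) \<union> (?P2 \<union> ?P3))) x y"
    using J13(3) J23(3) xo yo(1,2)
    by (intro Janiszewski J13(5) compact_imp_closed[OF J23(5)] con)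
  then have "connected_component (- (?P1 \<union> ?P2)) x y"
    by (rule connected_component_of_subset) auto
  then have "y \<in> inside (?P1 \<union> ?P2)"
    using x inside_same_component by blast
  then show False using yo(3) inside_Int_outside by blast
qed

text \<open>The arc \<open>c3\<close> cuts the inside of the cycle of \<open>c1\<close> and
  \<open>c2\<close> into the insides of the other two cycles. So \<open>S\<close> lies outside the
  first cycle, inside that of \<open>c1\<close> and \<open>c3\<close>, or inside that of
  \<open>c2\<close> and \<open>c3\<close>. The closures of these regions meet \<open>c3\<close>,
  \<open>c2\<close> and \<open>c1\<close>, respectively, at most in \<open>a\<close> and
  \<open>b\<close>.\<close>

lemma theta_curve_face_arc_inside:
  assumes th: "theta_curve a b c1 c2 c3"
    and "path_image c3 \<inter> inside (path_image c1 \<union> path_image c2) \<noteq> {}"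
    and S: "Topological_Spaces.connected S"
      "S \<inter> (path_image c1 \<union> path_image c2 \<union> path_image c3) = {}"
  shows "\<exists>c\<in>{c1, c2, c3}. closure S \<inter> path_image c \<subseteq> {a, b}"
proof -
  let ?P1 = "path_image c1" and ?P2 = "path_image c2" and ?P3 = "path_image c3"
  have "simple_path c1" "pathstart c1 = a" "pathfinish c1 = b"
    "simple_path c2" "pathstart c2 = a" "pathfinish c2 = b"
    "simple_path c3" "pathstart c3 = a" "pathfinish c3 = b" "a \<noteq> b"
    "?P1 \<inter> ?P2 = {a, b}" "?P1 \<inter> ?P3 = {a, b}" "?P2 \<inter> ?P3 = {a, b}"
    using th by (simp_all add: theta_curve_def arc_imp_simple_path)
  from split_inside_simple_closed_curve[OF this assms(2)] have split:
    "inside (?P1 \<union> ?P3) \<union> inside (?P2 \<union> ?P3) \<union> (?P3 - {a, b}) = inside (?P1 \<union> ?P2)" .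
  have cl: "closed (?P1 \<union> ?P2)" "closed (?P1 \<union> ?P3)" "closed (?P2 \<union> ?P3)"
    using th by (auto simp: theta_curve_def closed_arc_image)
  have "S \<subseteq> inside (?P1 \<union> ?P2) \<or> S \<subseteq> outside (?P1 \<union> ?P2)"
    using S by (intro connected_subset_inside_or_outside) auto
  then consider "S \<subseteq> outside (?P1 \<union> ?P2)" | "S \<subseteq> inside (?P1 \<union> ?P3)" | "S \<subseteq> inside (?P2 \<union> ?P3)"
  proof
    assume i: "S \<subseteq> inside (?P1 \<union> ?P2)"
    have "S \<subseteq> inside (?P1 \<union> ?P3) \<or> S \<subseteq> outside (?P1 \<union> ?P3)"
      using S by (intro connected_subset_inside_or_outside) auto
    moreover have "S \<subseteq> inside (?P2 \<union> ?P3)" if "S \<subseteq> outside (?P1 \<union> ?P3)"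
      using i that split S(2) inside_Int_outside[of "?P1 \<union> ?P3"] by blast
    ultimately show thesis using that by blast
  qed auto
  then show ?thesis
  proof cases
    case 1
    then have "closure S \<subseteq> ?P1 \<union> ?P2 \<union> outside (?P1 \<union> ?P2)"
      using closure_mono[OF 1] closure_outside_subset[OF cl(1)] by blast
    moreover have "?P3 - {a, b} \<subseteq> inside (?P1 \<union> ?P2)" using split by blast
    ultimately have "closure S \<inter> ?P3 \<subseteq> {a, b}"
      using inside_Int_outside[of "?P1 \<union> ?P2"] inside_no_overlap[of "?P1 \<union> ?P2"] by blast
    then show ?thesis by blast
  next
    case 2
    then have "closure S \<subseteq> ?P1 \<union> ?P3 \<union> inside (?P1 \<union> ?P3)"
      using closure_mono[OF 2] closure_inside_subset[OF cl(2)] by blast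
    moreover have "inside (?P1 \<union> ?P3) \<inter> ?P2 = {}"
      using split inside_no_overlap[of "?P1 \<union> ?P2"] by blast
    moreover have "(?P1 \<union> ?P3) \<inter> ?P2 \<subseteq> {a, b}" using th by (auto simp: theta_curve_def)
    ultimately have "closure S \<inter> ?P2 \<subseteq> {a, b}" by blast
    then show ?thesis by blast
  next
    case 3
    then have "closure S \<subseteq> ?P2 \<union> ?P3 \<union> inside (?P2 \<union> ?P3)"
      using closure_mono[OF 3] closure_inside_subset[OF cl(3)] by blast
    moreover have "inside (?P2 \<union> ?P3) \<inter> ?P1 = {}"
      using split inside_no_overlap[of "?P1 \<union> ?P2"] by blast
    moreover have "(?P2 \<union> ?P3) \<inter> ?P1 \<subseteq> {a, b}" using th by (auto simp: theta_curve_def)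
    ultimately have "closure S \<inter> ?P1 \<subseteq> {a, b}" by blast
    then show ?thesis by blast
  qed
qed

text \<open>A permutation of the arcs reduces this to the case in which the third enters the inside
  of the cycle of the other two.\<close>

lemma theta_curve_face:
  assumes th: "theta_curve a b c1 c2 c3"
    and S: "Topological_Spaces.connected S"
      "S \<inter> (path_image c1 \<union> path_image c2 \<union> path_image c3) = {}"
  shows "\<exists>c\<in>{c1, c2, c3}. closure S \<inter> path_image c \<subseteq> {a, b}"
proof -
  have th': "theta_curve a b c2 c3 c1" "theta_curve a b c1 c3 c2"
    using th theta_curve_rotate theta_curve_swap by blast+
  show ?thesis
    using theta_curve_arc_inside[OF th]
  proof (elim disjE)
    assume "path_image c3 \<inter> inside (path_image c1 \<union> path_image c2) \<noteq> {}"
    from theta_curve_face_arc_inside[OF th this S] show ?thesis .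
  next
    assume "path_image c2 \<inter> inside (path_image c1 \<union> path_image c3) \<noteq> {}"
    from theta_curve_face_arc_inside[OF th'(2) this S(1)] show ?thesis using S(2) by auto
  next
    assume "path_image c1 \<inter> inside (path_image c2 \<union> path_image c3) \<noteq> {}"
    from theta_curve_face_arc_inside[OF th'(1) this S(1)] show ?thesis using S(2) by auto
  qed
qed

text \<open>Injectivity makes this set the image of \<open>{0..<1}\<close>, an interval that is
  connected and has 1 in its closure.\<close>

lemma connected_arc_minus_finish:
  fixes g :: "real \<Rightarrow> complex"
  assumes "arc g"
  shows "Topological_Spaces.connected (path_image g - {pathfinish g})"
    and "pathfinish g \<in> closure (path_image g - {pathfinish g})"
proof -
  have eq: "path_image g - {pathfinish g} = g ` {0..<1}"
    using assms less_eq_real_def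
    by (auto simp: arc_def path_image_def pathfinish_def dest!: inj_onD)
  have g: "continuous_on {0..1} g" using assms by (simp add: arc_def path_def)
  then have "continuous_on {0..<1} g" by (rule continuous_on_subset) auto
  then show "Topological_Spaces.connected (path_image g - {pathfinish g})"
    unfolding eq by (rule connected_continuous_image) auto
  have "closure {0..<1::real} = {0..1}" by simp
  then have "g ` closure {0..<1} \<subseteq> closure (g ` {0..<1})"
    using g by (intro continuous_image_closure_subset[of "{0..1}"]) auto
  then show "pathfinish g \<in> closure (path_image g - {pathfinish g})"
    unfolding eq by (auto simp: pathfinish_def)
qed

section \<open>Nonplanarity of complete bipartite graphs\<close>

lemma planar_drawing_Int_subset:
  assumes "planar_drawing G p g" "e \<in> uedges G" "f \<in> uedges G" "e \<noteq> f"
  shows "path_image (g e) \<inter> path_image (g f) \<subseteq> p ` (e \<inter> f)"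
  using assms by (simp add: planar_drawing_def)

text \<open>A drawing attaches arcs to unordered edges, so the direction of \<open>g {u, v}\<close>
  is not determined; the arc is reversed if necessary.\<close>

lemma planar_drawing_edge_arc:
  assumes "planar_drawing G p g" "{u, v} \<in> uedges G"
  obtains h where "arc h" "pathstart h = p u" "pathfinish h = p v"
    "path_image h = path_image (g {u, v})"
proof -
  have g: "arc (g {u, v})" "{pathstart (g {u, v}), pathfinish (g {u, v})} = {p u, p v}"
    using assms unfolding planar_drawing_def by (metis image_empty image_insert)+
  then consider "pathstart (g {u, v}) = p u" "pathfinish (g {u, v}) = p v"
    | "pathstart (g {u, v}) = p v" "pathfinish (g {u, v}) = p u"
    by (metis doubleton_eq_iff)
  then show thesis
  proof cases
    case 1
    then show thesis using that[of "g {u, v}"] g by simp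
  next
    case 2
    then show thesis using that[of "reversepath (g {u, v})"] g by (simp add: arc_reversepath)
  qed
qed

text \<open>The paths from \<open>a1\<close> to \<open>a2\<close> through \<open>b1\<close>,
  \<open>b2\<close> and \<open>b3\<close> form a theta curve. The edges at \<open>a3\<close> without
  their ends in \<open>B\<close> form a connected set off this curve. Its closure contains the
  images of all three \<open>b\<close>, hence a point other than the ends on each arc, against
  \<open>theta_curve_face\<close>.\<close>

lemma complete_bipartite_subgraph_not_planar:
  assumes AB: "A \<inter> B = {}" and card: "3 \<le> card A" "3 \<le> card B" and V: "A \<union> B \<subseteq> pverts G"
    and E: "\<And>a b. a \<in> A \<Longrightarrow> b \<in> B \<Longrightarrow> {a, b} \<in> uedges G"
  shows "\<not> planar G"
proof
  assume "planar G"
  then obtain p g where D: "planar_drawing G p g" unfolding planar_def by blast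
  obtain a1 a2 a3 where a: "a1 \<in> A" "a2 \<in> A" "a3 \<in> A" "a1 \<noteq> a2" "a1 \<noteq> a3" "a2 \<noteq> a3"
    using card(1) by (metis card_3_iff obtain_subset_with_card_n insert_subset)
  obtain b1 b2 b3 where b: "b1 \<in> B" "b2 \<in> B" "b3 \<in> B" "b1 \<noteq> b2" "b1 \<noteq> b3" "b2 \<noteq> b3"
    using card(2) by (metis card_3_iff obtain_subset_with_card_n insert_subset)
  define P where "P a b = path_image (g {a, b})" for a b
  have inj: "inj_on p (A \<union> B)"
    using D V unfolding planar_drawing_def by (meson inj_on_subset)
  have p_neq: "p a \<noteq> p b" if "a \<in> A" "b \<in> B" for a b
    using inj that AB by (metis Int_iff Un_iff empty_iff inj_onD)
  have meet: "P a b \<inter> P a' b' \<subseteq> p ` ({a, b} \<inter> {a', b'})"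
    if "a \<in> A" "b \<in> B" "a' \<in> A" "b' \<in> B" "a \<noteq> a' \<or> b \<noteq> b'" for a b a' b'
  proof -
    have "a \<noteq> b'" using that AB by blast
    then have "{a, b} \<noteq> {a', b'}" using that(5) by (metis doubleton_eq_iff)
    then show ?thesis
      unfolding P_def using E that by (intro planar_drawing_Int_subset[OF D])
  qed
  have same_b: "P a b \<inter> P a' b \<subseteq> {p b}" if "a \<in> A" "b \<in> B" "a' \<in> A" "a \<noteq> a'" for a b a'
    using meet[of a b a' b] that AB by auto
  have same_a: "P a b \<inter> P a b' \<subseteq> {p a}" if "a \<in> A" "b \<in> B" "b' \<in> B" "b \<noteq> b'" for a b b'
    using meet[of a b a b'] that AB by auto
  have apart: "P a b \<inter> P a' b' = {}"
    if "a \<in> A" "b \<in> B" "a' \<in> A" "b' \<in> B" "a \<noteq> a'" "b \<noteq> b'" for a b a' b'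
  proof -
    have "{a, b} \<inter> {a', b'} = {}" using that AB by blast
    then show ?thesis using meet[of a b a' b'] that by auto
  qed
  have "\<forall>a\<in>A. \<forall>b\<in>B. \<exists>h. arc h \<and> pathstart h = p a \<and> pathfinish h = p b \<and> path_image h = P a b"
    unfolding P_def using planar_drawing_edge_arc[OF D E] by metis
  then obtain h where h: "\<And>a b. a \<in> A \<Longrightarrow> b \<in> B \<Longrightarrow>
      arc (h a b) \<and> pathstart (h a b) = p a \<and> pathfinish (h a b) = p b \<and> path_image (h a b) = P a b"
    by metis
  have ends: "p a \<in> P a b" "p b \<in> P a b" if "a \<in> A" "b \<in> B" for a b
    using h[OF that] pathstart_in_path_image pathfinish_in_path_image by metis+
  define c where "c b = h a1 b +++ reversepath (h a2 b)" for b
  have c: "arc (c b)" "pathstart (c b) = p a1" "pathfinish (c b) = p a2"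
    "path_image (c b) = P a1 b \<union> P a2 b" if "b \<in> B" for b
  proof -
    note h1 = h[OF a(1) that] and h2 = h[OF a(2) that]
    show "arc (c b)"
      unfolding c_def using h1 h2 same_b[OF a(1) that a(2,4)]
      by (intro arc_join) (auto simp: arc_reversepath)
    show "pathstart (c b) = p a1" "pathfinish (c b) = p a2"
      "path_image (c b) = P a1 b \<union> P a2 b"
      using h1 h2 by (simp_all add: c_def path_image_join)
  qed
  have c_meet: "path_image (c b) \<inter> path_image (c b') = {p a1, p a2}"
    if "b \<in> B" "b' \<in> B" "b \<noteq> b'" for b b'
  proof -
    have "P a1 b \<inter> P a1 b' \<subseteq> {p a1}" "P a2 b \<inter> P a2 b' \<subseteq> {p a2}"
      "P a1 b \<inter> P a2 b' = {}" "P a2 b \<inter> P a1 b' = {}"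
      using a that by (intro same_a apart; simp)+
    moreover have "p a1 \<in> P a1 b" "p a1 \<in> P a1 b'" "p a2 \<in> P a2 b" "p a2 \<in> P a2 b'"
      using ends a that by blast+
    ultimately show ?thesis unfolding c(4)[OF that(1)] c(4)[OF that(2)] by blast
  qed
  have "p a1 \<noteq> p a2" using inj a by (metis Un_iff inj_onD)
  then have theta: "theta_curve (p a1) (p a2) (c b1) (c b2) (c b3)"
    using c c_meet b unfolding theta_curve_def by simp
  define S where "S = (\<Union>b\<in>B. P a3 b - {p b})"
  have pa3: "p a3 \<in> P a3 b - {p b}" if "b \<in> B" for b
    using that ends(1)[OF a(3) that] p_neq[OF a(3) that] by blast
  have half: "Topological_Spaces.connected (P a3 b - {p b})" "p b \<in> closure (P a3 b - {p b})"
    if "b \<in> B" for b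
    using h[OF a(3) that] connected_arc_minus_finish[of "h a3 b"] by auto
  \<comment> \<open>The half-open arcs all contain \<open>p a3\<close>, so their union is
    connected.\<close>
  have "Topological_Spaces.connected S"
    unfolding S_def
  proof (rule connected_Union)
    show "\<Inter>((\<lambda>b. P a3 b - {p b}) ` B) \<noteq> {}" using pa3 by blast
  qed (use half in blast)
  moreover have "S \<inter> (path_image (c b1) \<union> path_image (c b2) \<union> path_image (c b3)) = {}"
  proof -
    \<comment> \<open>An edge at \<open>a3\<close> can meet an edge at another vertex of
      \<open>A\<close> only in a common end in \<open>B\<close>, and that end is removed.\<close>
    have "(P a3 b - {p b}) \<inter> P a b' = {}" if "a \<in> A" "a \<noteq> a3" "b \<in> B" "b' \<in> B" for a b b'
      using same_b[of a3 b a] apart[of a3 b a b'] that a(3) by (cases "b = b'") auto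
    then have "S \<inter> path_image (c b') = {}" if "b' \<in> B" for b'
      unfolding S_def c(4)[OF that] using that a by blast
    then show ?thesis using b by blast
  qed
  ultimately obtain b where b: "b \<in> B" "closure S \<inter> path_image (c b) \<subseteq> {p a1, p a2}"
    using theta_curve_face[OF theta] b by blast
  have "p b \<in> closure S"
    using half(2)[OF b(1)] b(1) closure_mono[of "P a3 b - {p b}" S] unfolding S_def by blast
  moreover have "p b \<in> path_image (c b)" using c(4) ends a b(1) by blast
  moreover have "p b \<notin> {p a1, p a2}" using p_neq a b(1) by (metis insert_iff empty_iff)
  ultimately show False using b(2) by blast
qed

section \<open>Straight-line drawings\<close>

text \<open>This reduces planarity to conditions on closed segments, stated for directed arcs. Each
  undirected edge is drawn along one chosen direction.\<close>

lemma planar_straight_lineI: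
  fixes p :: "'a \<Rightarrow> complex"
  assumes wf: "\<And>u v. (u, v) \<in> parcs G \<Longrightarrow> u \<in> pverts G \<and> v \<in> pverts G \<and> u \<noteq> v"
    and inj: "inj_on p (pverts G)"
    and vert: "\<And>u v w. (u, v) \<in> parcs G \<Longrightarrow> w \<in> pverts G \<Longrightarrow>
      p w \<in> closed_segment (p u) (p v) \<Longrightarrow> w \<in> {u, v}"
    and cross: "\<And>u v w x z. (u, v) \<in> parcs G \<Longrightarrow> (w, x) \<in> parcs G \<Longrightarrow> {u, v} \<noteq> {w, x} \<Longrightarrow>
      z \<in> closed_segment (p u) (p v) \<Longrightarrow> z \<in> closed_segment (p w) (p x) \<Longrightarrow> z \<in> p ` ({u, v} \<inter> {w, x})"
  shows "planar G"
proof -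
  have "\<forall>e\<in>uedges G. \<exists>u v. e = {u, v} \<and> (u, v) \<in> parcs G"
    unfolding uedges_def by blast
  then obtain s t where st: "\<And>e. e \<in> uedges G \<Longrightarrow> e = {s e, t e} \<and> (s e, t e) \<in> parcs G"
    by metis
  define g where "g e = linepath (p (s e)) (p (t e))" for e
  have g: "path_image (g e) = closed_segment (p (s e)) (p (t e))" for e
    by (simp add: g_def)
  have "planar_drawing G p g"
    unfolding planar_drawing_def
  proof (intro conjI ballI impI inj)
    fix e assume "e \<in> uedges G"
    note e = st[OF this]
    then have V: "s e \<in> pverts G" "t e \<in> pverts G" "s e \<noteq> t e" using wf by auto
    have pe: "p ` e = {p (s e), p (t e)}" using e by (metis image_insert image_empty)
    show "arc (g e)" using V inj by (auto simp: g_def inj_on_eq_iff)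
    show "{pathstart (g e), pathfinish (g e)} = p ` e" by (simp add: pe g_def)
    show "path_image (g e) \<inter> p ` pverts G = p ` e"
    proof
      show "path_image (g e) \<inter> p ` pverts G \<subseteq> p ` e"
        unfolding g pe using vert[of "s e" "t e"] e by blast
      show "p ` e \<subseteq> path_image (g e) \<inter> p ` pverts G" unfolding g pe using V by auto
    qed
  next
    fix e f assume "e \<in> uedges G" "f \<in> uedges G" "e \<noteq> f"
    then show "path_image (g e) \<inter> path_image (g f) \<subseteq> p ` (e \<inter> f)"
      unfolding g using cross[of "s e" "t e" "s f" "t f"] st[of e] st[of f] by auto
  qed
  then show ?thesis unfolding planar_def by blast
qed

text \<open>Each block \<open>k\<close> consists of at most two poles at \<open>(6k, \<plusminus>1)\<close> and at most six further
  vertices \<open>(6k + m, 0)\<close> with \<open>0 \<le> m \<le> 5\<close> on the real axis.\<close>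

lemma planar_double_fansI:
  fixes k m s :: "'a \<Rightarrow> int"
  assumes wf: "\<And>u v. (u, v) \<in> parcs G \<Longrightarrow> u \<in> pverts G \<and> v \<in> pverts G"
    and inj: "inj_on (\<lambda>v. (k v, m v, s v)) (pverts G)"
    and coords: "\<And>v. v \<in> pverts G \<Longrightarrow> s v \<in> {-1, 0, 1} \<and> 0 \<le> m v \<and> m v \<le> 5 \<and> (s v \<noteq> 0 \<longrightarrow> m v = 0)"
    and edge: "\<And>u v. (u, v) \<in> parcs G \<Longrightarrow> k u = k v \<and>
      (s u \<noteq> 0 \<and> s v = 0 \<or> s u = 0 \<and> s v \<noteq> 0 \<or> s u = 0 \<and> s v = 0 \<and> \<bar>m u - m v\<bar> = 1)"
  shows "planar G"
proof -
  \<comment> \<open>As \<open>m\<close> is at most 5, the spacing 6 puts the blocks into disjoint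
    vertical strips.\<close>
  define p where "p v = Complex (of_int (6 * k v + m v)) (of_int (s v))" for v
  have same: "u = v" if "u \<in> pverts G" "v \<in> pverts G" "k u = k v" "m u = m v" "s u = s v" for u v
    using inj that by (auto simp: inj_on_def)
  have block: "k v = i" if "v \<in> pverts G" "6 * of_int i \<le> Re (p v)" "Re (p v) \<le> 6 * of_int i + 5" for v i
  proof -
    have "6 * i \<le> 6 * k v + m v" "6 * k v + m v \<le> 6 * i + 5" using that(2,3) by (simp_all add: p_def)
    moreover have "0 \<le> m v" "m v \<le> 5" using coords[OF that(1)] by auto
    ultimately show ?thesis by linarith
  qed
  \<comment> \<open>\<open>z\<close> lies on the segment from the pole \<open>u\<close>, where
    \<open>t\<close> is 0, to the axis vertex \<open>v\<close>, where \<open>t\<close> is 1.\<close>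
  define pole where "pole u v z \<longleftrightarrow> \<bar>s u\<bar> = 1 \<and> s v = 0 \<and> (\<exists>t\<in>{0..1}. Im z = (1 - t) * of_int (s u) \<and>
      Re z = 6 * of_int (k u) + t * of_int (m v))" for u v and z :: complex
  \<comment> \<open>Here \<open>u\<close> is the right-hand neighbour of \<open>v\<close>, and
    \<open>t\<close> runs from \<open>v\<close> to \<open>u\<close>.\<close>
  define axis where "axis u v z \<longleftrightarrow> s u = 0 \<and> s v = 0 \<and> m u = m v + 1 \<and> Im z = 0 \<and>
      (\<exists>t\<in>{0..1}. Re z = 6 * of_int (k u) + of_int (m v) + t)" for u v and z :: complex
  have oriented: "pole u v z \<or> axis u v z"
    if H: "u \<in> pverts G" "v \<in> pverts G" "k u = k v" "s v = 0" "s u \<noteq> 0 \<or> m u = m v + 1"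
      "z \<in> closed_segment (p u) (p v)" for u v z
  proof -
    obtain t where t: "0 \<le> t" "t \<le> 1" "z = (1 - t) *\<^sub>R p u + t *\<^sub>R p v"
      using H(6) by (auto simp: closed_segment_def)
    have z: "Im z = (1 - t) * of_int (s u)"
      "Re z = (1 - t) * of_int (6 * k u + m u) + t * of_int (6 * k u + m v)"
      using t(3) H(3,4) by (simp_all add: p_def)
    show ?thesis
    proof (cases "s u = 0")
      case True
      with z H(5) have "Re z = 6 * of_int (k u) + of_int (m v) + (1 - t)"
        by (simp add: algebra_simps)
      then have "axis u v z" using True z H(4,5) t unfolding axis_def by (auto intro!: bexI[of _ "1 - t"])
      then show ?thesis by simp
    next
      case False
      then have "m u = 0" "\<bar>s u\<bar> = 1" using coords[OF H(1)] by auto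
      then have "pole u v z" using z t(1,2) H(4) unfolding pole_def
        by (auto intro!: bexI[of _ t] simp: algebra_simps)
      then show ?thesis by simp
    qed
  qed
  have seg: "\<exists>u' v'. {u', v'} = {u, v} \<and> u' \<in> pverts G \<and> v' \<in> pverts G \<and> k u' = k v' \<and>
      (pole u' v' z \<or> axis u' v' z)"
    if "(u, v) \<in> parcs G" "z \<in> closed_segment (p u) (p v)" for u v z
  proof -
    note V = wf[OF that(1)] and e = edge[OF that(1)]
    have zs: "z \<in> closed_segment (p v) (p u)" using that(2) by (simp add: closed_segment_commute)
    from e consider "s v = 0" "s u \<noteq> 0 \<or> m u = m v + 1" | "s u = 0" "s v \<noteq> 0 \<or> m v = m u + 1"
      by linarith
    then show ?thesis
    proof cases
      case 1
      then show ?thesis using oriented[of u v z] V e that(2) by blast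
    next
      case 2
      then show ?thesis using oriented[of v u z] V e zs by (metis insert_commute)
    qed
  qed
  \<comment> \<open>Every edge stays in the strip of its block, so edges of different blocks cannot
    meet.\<close>
  have range: "6 * of_int (k u) \<le> Re z" "Re z \<le> 6 * of_int (k u) + 5"
    if "u \<in> pverts G" "v \<in> pverts G" "pole u v z \<or> axis u v z" for u v z
  proof -
    have mv: "0 \<le> m v" "m v \<le> 5" "m u \<le> 5" using coords that by auto
    have "0 \<le> t * of_int (m v)" "t * of_int (m v) \<le> 5" if "0 \<le> t" "t \<le> 1" for t :: real
      using mv that mult_mono[of t 1 "of_int (m v)" 5] by auto
    then show "6 * of_int (k u) \<le> Re z" "Re z \<le> 6 * of_int (k u) + 5"
      using that(3) mv unfolding pole_def axis_def by fastforce+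
  qed
  have k_eq: "k u = k w"
    if "u \<in> pverts G" "v \<in> pverts G" "pole u v z \<or> axis u v z"
       "w \<in> pverts G" "x \<in> pverts G" "pole w x z \<or> axis w x z" for u v w x z
    using range[OF that(1-3)] range[OF that(4-6)] by linarith
  have pole0: "z = p v" if "pole u v z" "Im z = 0" "k u = k v" for u v z
    using that by (auto simp: pole_def p_def complex_eq_iff)
  have axis_end: "w = u \<or> w = v"
    if "axis u v (p w)" "u \<in> pverts G" "v \<in> pverts G" "w \<in> pverts G" "k u = k v" for u v w
  proof -
    have kw: "k w = k u" using block[OF that(4)] range[OF that(2,3)] that(1) by blast
    have "m w = m v \<or> m w = m u" "s w = 0"
      using that(1) kw unfolding axis_def p_def by auto
    then show ?thesis using same that kw unfolding axis_def by metis
  qed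
  have pole_end: "w = u \<or> w = v"
    if H: "pole u v (p w)" "u \<in> pverts G" "v \<in> pverts G" "w \<in> pverts G" "k u = k v" for u v w
  proof -
    have kw: "k w = k u" using block[OF H(4)] range[OF H(2,3)] H(1) by blast
    show ?thesis
    proof (cases "s w = 0")
      case True
      then have "p w = p v" using pole0[OF H(1)] H(5) by (simp add: p_def)
      then show ?thesis using kw H(5) same[OF H(4,3)] by (simp add: p_def)
    next
      case False
      obtain t where t: "0 \<le> t" "t \<le> 1" "real_of_int (s w) = (1 - t) * of_int (s u)" "\<bar>s u\<bar> = 1"
        using H(1) unfolding pole_def p_def by auto
      \<comment> \<open>A point of height 1 or -1 on the segment must have the height of the
        pole.\<close>
      have "s w = s u"
        using coords[OF H(4)] False t by (auto simp: abs_if split: if_splits)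
      moreover have "m w = m u" using coords[OF H(4)] coords[OF H(2)] False t(4) by auto
      ultimately show ?thesis using same[OF H(4,2) kw] by simp
    qed
  qed
  have pole_pole: "{u, v} = {w, x} \<or> z \<in> p ` ({u, v} \<inter> {w, x})"
    if H: "pole u v z" "pole w x z" "k u = k v" "k w = k x" "k u = k w"
      "u \<in> pverts G" "v \<in> pverts G" "w \<in> pverts G" "x \<in> pverts G" for u v w x z
  proof (cases "Im z = 0")
    case True
    then have "z = p v" "z = p x" using pole0 H by auto
    then have "v = x" using same[OF H(7,9)] H(3-5) by (simp add: p_def)
    then show ?thesis using \<open>z = p v\<close> by blast
  next
    case False
    obtain t where t: "0 \<le> t" "t \<le> 1" "Im z = (1 - t) * of_int (s u)"
      "Re z = 6 * of_int (k u) + t * of_int (m v)" "\<bar>s u\<bar> = 1" "s v = 0"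
      using H(1) unfolding pole_def by auto
    obtain t' where t': "0 \<le> t'" "t' \<le> 1" "Im z = (1 - t') * of_int (s w)"
      "Re z = 6 * of_int (k w) + t' * of_int (m x)" "\<bar>s w\<bar> = 1" "s x = 0"
      using H(2) unfolding pole_def by auto
    \<comment> \<open>Off the axis, the sign of \<open>Im z\<close> determines the pole and its
      modulus determines the parameter. Then \<open>Re z\<close> determines the other end, unless
      \<open>z\<close> is the pole itself.\<close>
    have s: "s u = s w" "t = t'" using False t(1-3,5) t'(1-3,5) by (auto simp: abs_if split: if_splits)
    moreover have "m u = m w" using coords[OF H(6)] coords[OF H(8)] t(5) t'(5) by auto
    ultimately have uw: "u = w" using same[OF H(6,8,5)] by simp
    show ?thesis
    proof (cases "t = 0")
      case True
      then have "z = p u" using t coords[OF H(6)] by (auto simp: p_def complex_eq_iff)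
      then show ?thesis using uw by blast
    next
      case False
      then have "m v = m x" using t(4) t'(4) s H(5) by simp
      then have "v = x" using same[OF H(7,9)] H(3-5) t(6) t'(6) by simp
      then show ?thesis using uw by simp
    qed
  qed
  \<comment> \<open>A pole segment meets the axis only in its end \<open>v\<close>, and a vertex on
    an axis edge is one of the ends of that edge.\<close>
  have pole_axis: "z \<in> p ` ({u, v} \<inter> {w, x})"
    if "pole u v z" "axis w x z" "k u = k v" "k w = k x"
      "u \<in> pverts G" "v \<in> pverts G" "w \<in> pverts G" "x \<in> pverts G" for u v w x z
  proof -
    have z: "z = p v" using pole0 that(1-3) by (auto simp: axis_def)
    then have "v = w \<or> v = x" using axis_end that by blast
    then show ?thesis using z by blast
  qed
  have axis_axis: "{u, v} = {w, x} \<or> z \<in> p ` ({u, v} \<inter> {w, x})"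
    if H: "axis u v z" "axis w x z" "k u = k v" "k w = k x" "k u = k w"
      "u \<in> pverts G" "v \<in> pverts G" "w \<in> pverts G" "x \<in> pverts G" for u v w x z
  proof -
    obtain t where t: "0 \<le> t" "t \<le> 1" "Re z = 6 * of_int (k u) + of_int (m v) + t"
      "s u = 0" "s v = 0" "m u = m v + 1" "Im z = 0"
      using H(1) unfolding axis_def by auto
    obtain t' where t': "0 \<le> t'" "t' \<le> 1" "Re z = 6 * of_int (k w) + of_int (m x) + t'"
      "s w = 0" "s x = 0" "m w = m x + 1"
      using H(2) unfolding axis_def by auto
    \<comment> \<open>Two unit intervals with integer ends that meet are equal or share just one
      end.\<close>
    have "\<bar>m v - m x\<bar> \<le> 1" using t(1-3) t'(1-3) H(5) by linarith
    then consider "m v = m x" | "m v = m w" | "m x = m u"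
      using t(6) t'(6) by linarith
    then show ?thesis
    proof cases
      case 1
      then have "v = x" "u = w" using same H t t' by auto
      then show ?thesis by simp
    next
      case 2
      then have "v = w" using same H t t' by auto
      moreover have "z = p v" using 2 t t' H(3,5) by (simp add: p_def complex_eq_iff)
      ultimately show ?thesis by blast
    next
      case 3
      then have "x = u" using same H t t' by auto
      moreover have "z = p u" using 3 t t' H(3,5) by (simp add: p_def complex_eq_iff)
      ultimately show ?thesis by blast
    qed
  qed
  show ?thesis
  proof (rule planar_straight_lineI[of G p])
    show "u \<in> pverts G \<and> v \<in> pverts G \<and> u \<noteq> v" if "(u, v) \<in> parcs G" for u v
      using wf[OF that] edge[OF that] by auto
    show "inj_on p (pverts G)"
    proof (rule inj_onI)
      fix u v assume uv: "u \<in> pverts G" "v \<in> pverts G" "p u = p v"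
      have "k u = k v"
        using block[OF uv(1), of "k v"] coords[OF uv(2)] unfolding uv(3) by (simp add: p_def)
      then show "u = v" using same[OF uv(1,2)] uv(3) by (simp add: p_def)
    qed
    show "w \<in> {u, v}"
      if "(u, v) \<in> parcs G" "w \<in> pverts G" "p w \<in> closed_segment (p u) (p v)" for u v w
      using seg[OF that(1,3)] pole_end axis_end that(2) by (metis insert_iff)
    show "z \<in> p ` ({u, v} \<inter> {w, x})"
      if H: "(u, v) \<in> parcs G" "(w, x) \<in> parcs G" "{u, v} \<noteq> {w, x}"
        "z \<in> closed_segment (p u) (p v)" "z \<in> closed_segment (p w) (p x)" for u v w x z
    proof -
      obtain u' v' where u: "{u', v'} = {u, v}" "u' \<in> pverts G" "v' \<in> pverts G" "k u' = k v'"
        "pole u' v' z \<or> axis u' v' z"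
        using seg[OF H(1,4)] by blast
      obtain w' x' where w: "{w', x'} = {w, x}" "w' \<in> pverts G" "x' \<in> pverts G" "k w' = k x'"
        "pole w' x' z \<or> axis w' x' z"
        using seg[OF H(2,5)] by blast
      have k: "k u' = k w'" using k_eq u w by blast
      have ne: "{u', v'} \<noteq> {w', x'}" using H(3) u(1) w(1) by simp
      have "z \<in> p ` ({u', v'} \<inter> {w', x'})"
        using u(5) w(5)
      proof (elim disjE)
        assume "pole u' v' z" "pole w' x' z"
        then show ?thesis using pole_pole u w k ne by blast
      next
        assume "pole u' v' z" "axis w' x' z"
        then show ?thesis using pole_axis u w by blast
      next
        assume "axis u' v' z" "pole w' x' z"
        then show ?thesis using pole_axis[of w' x' z u' v'] u w by (simp add: Int_commute)
      next
        assume "axis u' v' z" "axis w' x' z"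
        then show ?thesis using axis_axis u w k ne by blast
      qed
      then show ?thesis using u(1) w(1) by simp
    qed
  qed
qed

section \<open>The zero-divisor graphs\<close>

lemma mat2_eq_iff: "mat2 a b c e = mat2 a' b' c' e' \<longleftrightarrow> a = a' \<and> b = b' \<and> c = c' \<and> e = e'"
  by (metis mat2_nth)

lemma mat2_mult:
  "mat2 a b c e ** mat2 a' b' c' e' =
    mat2 (a * a' + b * c') (a * b' + b * e') (c * a' + e * c') (c * b' + e * e')"
  by (simp add: vec_eq_iff forall_2 matrix_matrix_mult_def sum_2)

lemma mat2_eq_0_iff: "mat2 a b c e = 0 \<longleftrightarrow> a = 0 \<and> b = 0 \<and> c = 0 \<and> e = 0"
  by (auto simp: vec_eq_iff forall_2)

text \<open>The scalar is multiplied into the entries, which replaces the real scaling in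
  \<open>S_tc1\<close> by complex multiplication.\<close>

definition tc_mat :: "int \<Rightarrow> complex \<Rightarrow> complex^2^2" where
  "tc_mat l t = mat2 (of_int l) (of_int l * t) (of_int l * t\<^sup>2) (of_int l * t ^ 3)"

lemma S_tc1_eq: "S_tc1 t N = {tc_mat l t | l. 1 \<le> \<bar>l\<bar> \<and> \<bar>l\<bar> \<le> int N}"
proof -
  have "of_int l *\<^sub>R mat2 1 t (t\<^sup>2) (t ^ 3) = tc_mat l t" for l
    by (simp add: vec_eq_iff forall_2 tc_mat_def scaleR_conv_of_real[where 'a = complex])
  then show ?thesis by (simp add: S_tc1_def)
qed

lemma tc_mat_eq_iff: "tc_mat l t = tc_mat l' t' \<longleftrightarrow> l = l' \<and> (l = 0 \<or> t = t')"
  by (auto simp: tc_mat_def mat2_eq_iff)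

text \<open>\<open>tc_mat l t\<close> is \<open>l\<close> times the column \<open>(1, t^2)\<close>
  times the row \<open>(1, t)\<close>. The product therefore has the scalar factor
  \<open>1 + t * t'^2\<close>, the row of the first matrix times the column of the second; what
  remains has the nonzero upper left entry \<open>l * l'\<close>.\<close>

lemma tc_mat_mult_eq_0_iff:
  assumes "l \<noteq> 0" "l' \<noteq> 0"
  shows "tc_mat l t ** tc_mat l' t' = 0 \<longleftrightarrow> 1 + t * t'\<^sup>2 = 0"
proof -
  let ?c = "of_int l * of_int l' :: complex" and ?f = "1 + t * t'\<^sup>2"
  have "tc_mat l t ** tc_mat l' t' = mat2 (?c * ?f) (?c * t' * ?f) (?c * t\<^sup>2 * ?f) (?c * t\<^sup>2 * t' * ?f)"
    by (simp add: tc_mat_def mat2_mult mat2_eq_iff algebra_simps power2_eq_square power3_eq_cube)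
  then show ?thesis using assms by (auto simp: mat2_eq_0_iff)
qed

lemma parcs_induced_zero_divisor_graph:
  assumes "W \<subseteq> pverts (zero_divisor_graph R)"
  shows "parcs (mk_symmetric (with_proj (zero_divisor_graph R) \<restriction> W)) =
    {(A, B). A \<in> W \<and> B \<in> W \<and> A \<noteq> B \<and> (A ** B = 0 \<or> B ** A = 0)}"
  using assms by (fastforce simp: parcs_mk_symmetric zero_divisor_graph_def Let_def)

lemma verts_Gamma1: "pverts (Gamma1 d N) = S_tc1 0 N \<union> S_tc2 N"
  and arcs_Gamma1: "parcs (Gamma1 d N) = {(A, B). A \<in> S_tc1 0 N \<union> S_tc2 N \<and>
    B \<in> S_tc1 0 N \<union> S_tc2 N \<and> A \<noteq> B \<and> (A ** B = 0 \<or> B ** A = 0)}"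
  unfolding Gamma1_def
  using parcs_induced_zero_divisor_graph[OF Gamma_verts_subset(1)] by simp_all

lemma verts_Gamma2: "pverts (Gamma2_un d N) = (\<Union>j\<in>U_set d. S_tc1 j N)"
  and arcs_Gamma2: "parcs (Gamma2_un d N) = {(A, B). A \<in> (\<Union>j\<in>U_set d. S_tc1 j N) \<and>
    B \<in> (\<Union>j\<in>U_set d. S_tc1 j N) \<and> A \<noteq> B \<and> (A ** B = 0 \<or> B ** A = 0)}"
  unfolding Gamma2_un_def Gamma2_def
  using parcs_induced_zero_divisor_graph[OF Gamma_verts_subset(2)] by simp_all

section \<open>Nonplanarity for n at least 2\<close>

lemma card_inj_int_image_ge_3:
  fixes f :: "int \<Rightarrow> 'a"
  assumes "inj f" "2 \<le> n"
  shows "3 \<le> card {f l | l. 1 \<le> \<bar>l\<bar> \<and> \<bar>l\<bar> \<le> int n}"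
proof -
  let ?L = "{l. 1 \<le> \<bar>l\<bar> \<and> \<bar>l\<bar> \<le> int n}"
  have "?L \<subseteq> {- int n..int n}" by auto
  then have "finite ?L" using finite_subset by blast
  \<comment> \<open>The value 2 is admissible because \<open>n\<close> is at least 2; for
    \<open>n = 1\<close> only 1 and -1 remain.\<close>
  then have "card {1, -1, 2::int} \<le> card ?L" using assms(2) by (intro card_mono) auto
  also have "card ?L = card (f ` ?L)"
    by (rule card_image[symmetric]) (rule inj_on_subset[OF assms(1) subset_UNIV])
  also have "f ` ?L = {f l | l. 1 \<le> \<bar>l\<bar> \<and> \<bar>l\<bar> \<le> int n}" by auto
  finally show ?thesis by simp
qed

lemma card_S_tc1_ge_3: "2 \<le> N \<Longrightarrow> 3 \<le> card (S_tc1 t N)"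
  unfolding S_tc1_eq by (rule card_inj_int_image_ge_3) (auto simp: inj_def tc_mat_eq_iff)

lemma card_S_tc2_ge_3: "2 \<le> N \<Longrightarrow> 3 \<le> card (S_tc2 N)"
  unfolding S_tc2_def by (rule card_inj_int_image_ge_3) (auto simp: inj_def mat2_eq_iff)

lemma Gamma1_not_planar:
  assumes "2 \<le> n"
  shows "\<not> planar (Gamma1 d n)"
proof (rule complete_bipartite_subgraph_not_planar)
  show disj: "S_tc1 0 n \<inter> S_tc2 n = {}"
    by (auto simp: S_tc1_eq S_tc2_def tc_mat_def mat2_eq_iff)
  fix A B assume AB: "A \<in> S_tc1 0 n" "B \<in> S_tc2 n"
  then have "A ** B = 0"
    by (auto simp: S_tc1_eq S_tc2_def tc_mat_def mat2_mult mat2_eq_0_iff)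
  then show "{A, B} \<in> uedges (Gamma1 d n)"
    using AB disj unfolding uedges_def arcs_Gamma1 by blast
qed (use assms in \<open>simp_all add: card_S_tc1_ge_3 card_S_tc2_ge_3 verts_Gamma1\<close>)

text \<open>The values \<open>t = -1\<close> and \<open>t' = 1\<close> satisfy
  \<open>1 + t * t'^2 = 0\<close>, and both belong to \<open>U_set d\<close> for every
  \<open>d\<close>.\<close>

lemma Gamma2_un_not_planar:
  assumes "2 \<le> n"
  shows "\<not> planar (Gamma2_un d n)"
proof (rule complete_bipartite_subgraph_not_planar)
  have U: "1 \<in> U_set d" "-1 \<in> U_set d" by (simp_all add: U_set_def Let_def)
  show disj: "S_tc1 (-1) n \<inter> S_tc1 1 n = {}"
    by (auto simp: S_tc1_eq tc_mat_eq_iff)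
  show "S_tc1 (-1) n \<union> S_tc1 1 n \<subseteq> pverts (Gamma2_un d n)"
    using U unfolding verts_Gamma2 by blast
  fix A B assume AB: "A \<in> S_tc1 (-1) n" "B \<in> S_tc1 1 n"
  then have "A ** B = 0"
    by (auto simp: S_tc1_eq tc_mat_mult_eq_0_iff)
  then show "{A, B} \<in> uedges (Gamma2_un d n)"
    using AB disj U unfolding uedges_def arcs_Gamma2 by blast
qed (use assms in \<open>simp_all add: card_S_tc1_ge_3\<close>)

section \<open>Planarity for n = 1\<close>

lemma one_le_abs_le_one_iff: "1 \<le> \<bar>l\<bar> \<and> \<bar>l\<bar> \<le> int 1 \<longleftrightarrow> l = 1 \<or> l = -1"
  by auto

lemma S_tc1_1_eq: "S_tc1 t 1 = {tc_mat 1 t, tc_mat (-1) t}"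
  unfolding S_tc1_eq one_le_abs_le_one_iff by auto

lemma planar_Gamma1_1: "planar (Gamma1 d 1)"
proof -
  have V: "S_tc1 0 1 \<union> S_tc2 1 =
      {mat2 1 0 0 0, mat2 (-1) 0 0 0, mat2 0 0 0 1, mat2 0 0 0 (-1)}"
    unfolding S_tc1_1_eq S_tc2_def one_le_abs_le_one_iff
    by (auto simp: tc_mat_def mat2_eq_iff intro: exI[of _ 1] exI[of _ "-1"])
  \<comment> \<open>The two matrices with nonzero upper left entry become the poles, the other two
    the axis points 0 and 1.\<close>
  define m where "m A = (if A $ 2 $ 2 = -1 then 1 else 0 :: int)" for A :: "complex^2^2"
  define s where "s A = (if A $ 1 $ 1 = 1 then 1 else if A $ 1 $ 1 = -1 then -1 else 0 :: int)"
    for A :: "complex^2^2"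
  show ?thesis
  proof (rule planar_double_fansI[of _ "\<lambda>_. 0" m s]; unfold verts_Gamma1 arcs_Gamma1 V)
    let ?V = "{mat2 1 0 0 0, mat2 (-1) 0 0 0, mat2 0 0 0 1, mat2 0 0 0 (-1)} :: (complex^2^2) set"
    show "inj_on (\<lambda>A. (0::int, m A, s A)) ?V"
      by (intro inj_onI, elim insertE) (simp_all add: m_def s_def)
    show "s A \<in> {-1, 0, 1} \<and> 0 \<le> m A \<and> m A \<le> 5 \<and> (s A \<noteq> 0 \<longrightarrow> m A = 0)" if "A \<in> ?V" for A
      using that by (elim insertE) (simp_all add: m_def s_def)
    fix A B assume AB: "(A, B) \<in> {(A, B). A \<in> ?V \<and> B \<in> ?V \<and> A \<noteq> B \<and> (A ** B = 0 \<or> B ** A = 0)}"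
    then show "A \<in> ?V \<and> B \<in> ?V" by simp
    have "A \<in> ?V" "B \<in> ?V" "A \<noteq> B" "A ** B = 0 \<or> B ** A = 0" using AB by simp_all
    then show "(0::int) = 0 \<and>
        (s A \<noteq> 0 \<and> s B = 0 \<or> s A = 0 \<and> s B \<noteq> 0 \<or> s A = 0 \<and> s B = 0 \<and> \<bar>m A - m B\<bar> = 1)"
      by (elim insertE) (simp_all add: m_def s_def mat2_mult mat2_eq_0_iff)
  qed
qed

text \<open>The vertices \<open>l M\<^sub>t\<close> with \<open>l = \<plusminus>1\<close> are drawn as the two poles of the block \<open>\<kappa> t\<close> if \<open>pole t\<close>,
  and as the neighbouring points \<open>off t\<close>, \<open>off t + 1\<close> of its axis otherwise.\<close>

lemma planar_Gamma2_un_1I: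
  fixes \<kappa> off :: "complex \<Rightarrow> int"
  assumes off: "\<And>t. t \<in> U_set d \<Longrightarrow> off t \<in> {0, 2, 4}"
    and inj: "\<And>t u. t \<in> U_set d \<Longrightarrow> u \<in> U_set d \<Longrightarrow> \<kappa> t = \<kappa> u \<Longrightarrow> pole t = pole u \<Longrightarrow>
      \<not> pole t \<longrightarrow> off t = off u \<Longrightarrow> t = u"
    and edge: "\<And>t u. t \<in> U_set d \<Longrightarrow> u \<in> U_set d \<Longrightarrow> 1 + t * u\<^sup>2 = 0 \<Longrightarrow>
      \<kappa> t = \<kappa> u \<and> \<not> (pole t \<and> pole u) \<and> (\<not> pole t \<and> \<not> pole u \<longrightarrow> t = u)"
  shows "planar (Gamma2_un d 1)"
proof -
  \<comment> \<open>On \<open>tc_mat l t\<close> with nonzero \<open>l\<close> this quotient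
    recovers \<open>t\<close>, and the upper left entry recovers \<open>l\<close>.\<close>
  define \<tau> where "\<tau> A = A $ 1 $ 2 / A $ 1 $ 1" for A :: "complex^2^2"
  define k where "k A = \<kappa> (\<tau> A)" for A
  define m where "m A = (if pole (\<tau> A) then 0 else if A $ 1 $ 1 = 1 then off (\<tau> A) else off (\<tau> A) + 1)" for A
  define s where "s A = (if pole (\<tau> A) then if A $ 1 $ 1 = 1 then 1 else -1 else 0 :: int)" for A
  have V: "A \<in> pverts (Gamma2_un d 1) \<longleftrightarrow> (\<exists>t\<in>U_set d. \<exists>l\<in>{1, -1}. A = tc_mat l t)" for A
    unfolding verts_Gamma2 S_tc1_1_eq by auto
  have [simp]: "\<tau> (tc_mat l t) = t" "tc_mat l t $ 1 $ 1 = of_int l" if "l \<in> {1, -1}" for l t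
    using that by (auto simp: \<tau>_def tc_mat_def)
  have code: "k (tc_mat l t) = \<kappa> t" "m (tc_mat l t) = (if pole t then 0 else if l = 1 then off t else off t + 1)"
    "s (tc_mat l t) = (if pole t then l else 0)" if "l \<in> {1, -1}" for l t
    using that by (auto simp: k_def m_def s_def)
  show ?thesis
  proof (rule planar_double_fansI[of _ k m s])
    show "A \<in> pverts (Gamma2_un d 1) \<and> B \<in> pverts (Gamma2_un d 1)"
      if "(A, B) \<in> parcs (Gamma2_un d 1)" for A B
      using that unfolding verts_Gamma2 arcs_Gamma2 by blast
    show "inj_on (\<lambda>v. (k v, m v, s v)) (pverts (Gamma2_un d 1))"
    proof (rule inj_onI)
      fix A B assume A: "A \<in> pverts (Gamma2_un d 1)" and B: "B \<in> pverts (Gamma2_un d 1)"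
        and eq: "(k A, m A, s A) = (k B, m B, s B)"
      obtain t l where t: "t \<in> U_set d" "l \<in> {1, -1}" "A = tc_mat l t" using A[unfolded V] by blast
      obtain u l' where u: "u \<in> U_set d" "l' \<in> {1, -1}" "B = tc_mat l' u" using B[unfolded V] by blast
      have k: "\<kappa> t = \<kappa> u" using eq t u code by simp
      have s: "pole t = pole u" "pole t \<longrightarrow> l = l'"
        using eq t(2) u(2) unfolding t(3) u(3) code[OF t(2)] code[OF u(2)]
        by (auto split: if_splits)
      \<comment> \<open>Since \<open>off\<close> takes values in \<open>{0, 2, 4}\<close>, the
        parity of the axis position gives the sign, and the position then gives
        \<open>off\<close>.\<close>
      have m: "off t = off u \<and> l = l'" if "\<not> pole t"
        using eq that s(1) t(2) u(2) off[OF t(1)] off[OF u(1)]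
        unfolding t(3) u(3) code[OF t(2)] code[OF u(2)] by (auto split: if_splits)
      show "A = B" using inj[OF t(1) u(1) k s(1)] m s t(3) u(3) by blast
    qed
    show "s A \<in> {-1, 0, 1} \<and> 0 \<le> m A \<and> m A \<le> 5 \<and> (s A \<noteq> 0 \<longrightarrow> m A = 0)"
      if H: "A \<in> pverts (Gamma2_un d 1)" for A
    proof -
      obtain t l where t: "t \<in> U_set d" "l \<in> {1, -1}" "A = tc_mat l t" using H[unfolded V] by blast
      show ?thesis
        using off[OF t(1)] t(2) unfolding t(3) code[OF t(2)] by auto
    qed
    show "k A = k B \<and>
        (s A \<noteq> 0 \<and> s B = 0 \<or> s A = 0 \<and> s B \<noteq> 0 \<or> s A = 0 \<and> s B = 0 \<and> \<bar>m A - m B\<bar> = 1)"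
      if AB: "(A, B) \<in> parcs (Gamma2_un d 1)" for A B
    proof -
      have A: "A \<in> pverts (Gamma2_un d 1)" and B: "B \<in> pverts (Gamma2_un d 1)" and ne: "A \<noteq> B"
        and 0: "A ** B = 0 \<or> B ** A = 0"
        using AB unfolding verts_Gamma2 arcs_Gamma2 by auto
      obtain t l where t: "t \<in> U_set d" "l \<in> {1, -1}" "A = tc_mat l t" using A[unfolded V] by blast
      obtain u l' where u: "u \<in> U_set d" "l' \<in> {1, -1}" "B = tc_mat l' u" using B[unfolded V] by blast
      have "1 + t * u\<^sup>2 = 0 \<or> 1 + u * t\<^sup>2 = 0"
        using 0 t u tc_mat_mult_eq_0_iff[of l l'] tc_mat_mult_eq_0_iff[of l' l] by auto
      then have e: "\<kappa> t = \<kappa> u \<and> \<not> (pole t \<and> pole u) \<and> (\<not> pole t \<and> \<not> pole u \<longrightarrow> t = u)"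
        using edge[OF t(1) u(1)] edge[OF u(1) t(1)] by auto
      \<comment> \<open>Adjacent axis vertices have the same \<open>t\<close>, so they differ in
        sign and lie at distance 1.\<close>
      moreover have "t = u \<longrightarrow> l \<noteq> l'" using ne t u by auto
      ultimately show ?thesis
        using t(2) u(2) unfolding t(3) u(3) code[OF t(2)] code[OF u(2)] by auto
    qed
  qed
qed

text \<open>The two vertices with \<open>t = 1\<close> are the poles. Every other vertex is adjacent
  to both, and the only axis edge joins the two vertices with \<open>t = -1\<close>.\<close>

lemma planar_Gamma2_un_1_gaussian: "planar (Gamma2_un 1 1)"
proof -
  have U: "U_set 1 = {1, -1, \<i>, -\<i>}" by (simp add: U_set_def)
  have distinct: "\<i> \<noteq> 1" "\<i> \<noteq> -1" "-\<i> \<noteq> 1" "\<i> \<noteq> -\<i>" by (simp_all add: complex_eq_iff)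
  define off :: "complex \<Rightarrow> int" where "off t = (if t = \<i> then 2 else if t = -\<i> then 4 else 0)" for t
  have off: "off 1 = 0" "off (-1) = 0" "off \<i> = 2" "off (-\<i>) = 4"
    using distinct by (auto simp: off_def)
  show ?thesis
  proof (rule planar_Gamma2_un_1I[where \<kappa> = "\<lambda>_. 0" and pole = "\<lambda>t. t = 1" and off = off]; unfold U)
    fix t u :: complex assume t: "t \<in> {1, -1, \<i>, -\<i>}" and u: "u \<in> {1, -1, \<i>, -\<i>}"
    show "off t \<in> {0, 2, 4}" using t off by auto
    show "t = u" if "(t = 1) = (u = 1)" "t \<noteq> 1 \<longrightarrow> off t = off u"
      using t u that off distinct by (elim insertE) simp_all
    assume "1 + t * u\<^sup>2 = 0"
    then have "t * u\<^sup>2 = -1" by (simp add: eq_neg_iff_add_eq_0 add.commute)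
    moreover have "u\<^sup>2 = 1 \<and> (u = 1 \<or> u = -1) \<or> u\<^sup>2 = -1 \<and> u \<noteq> 1" using u distinct by auto
    ultimately have "t = -1 \<and> (u = 1 \<or> u = -1) \<or> t = 1 \<and> u \<noteq> 1" by auto
    then show "(0::int) = 0 \<and> \<not> (t = 1 \<and> u = 1) \<and> (t \<noteq> 1 \<and> u \<noteq> 1 \<longrightarrow> t = u)" by auto
  qed
qed

text \<open>This lets the case \<open>d = 3\<close> and the cases with only 1 and -1 in
  \<open>U_set d\<close> be treated together.\<close>

lemma U_set_power_6:
  assumes "t \<in> U_set d" "d \<noteq> 1"
  shows "t ^ 6 = 1"
proof -
  let ?w = "cis (2 * pi / 3)"
  have "?w ^ 3 = 1" by (simp add: Complex.DeMoivre)
  then have "?w ^ 6 = 1" "(?w ^ 2) ^ 6 = 1"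
    using power_mult[of ?w 3 2] power_mult[of ?w 3 4] by (simp_all flip: power_mult)
  then show ?thesis using assms by (auto simp: U_set_def Let_def split: if_splits)
qed

text \<open>For sixth roots of unity, \<open>1 + t u\<^sup>2 = 0\<close> forces \<open>t\<^sup>3 = -1\<close> and \<open>t\<^sup>2 = u\<^sup>2\<close>. So the graph splits
  into blocks indexed by \<open>t\<^sup>2\<close>, whose poles are the vertices with \<open>t\<^sup>3 = 1\<close>.\<close>

lemma planar_Gamma2_un_1_not_gaussian:
  assumes "d \<noteq> 1"
  shows "planar (Gamma2_un d 1)"
proof -
  \<comment> \<open>The squares \<open>t^2\<close> are to index the blocks; \<open>f\<close> turns
    them into distinct numbers.\<close>
  have "finite (U_set d)" by (simp add: U_set_def Let_def)
  then have "countable (power2 ` U_set d)" by (intro countable_finite finite_imageI)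
  then obtain f :: "complex \<Rightarrow> nat" where f: "inj_on f (power2 ` U_set d)"
    unfolding countable_def ..
  have cube: "t ^ 3 = 1 \<or> t ^ 3 = -1" if "t \<in> U_set d" for t
    using U_set_power_6[OF that assms] power2_eq_1_iff[of "t ^ 3"] by (simp flip: power_mult)
  \<comment> \<open>\<open>t\<close> is the quotient of \<open>t^3\<close> by \<open>t^2\<close>.
    Hence a block holds at most one \<open>t\<close> with cube 1 and one with cube -1, and a
    constant \<open>off\<close> suffices.\<close>
  have determined: "t = u" if "t\<^sup>2 = u\<^sup>2" "t ^ 3 = u ^ 3" "t \<noteq> 0" for t u :: complex
  proof -
    have "t * t\<^sup>2 = u * t\<^sup>2" using that(1,2) by (simp add: power3_eq_cube power2_eq_square mult.assoc)
    then show ?thesis using that(3) by simp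
  qed
  show ?thesis
  proof (rule planar_Gamma2_un_1I[where \<kappa> = "\<lambda>t. int (f (t\<^sup>2))" and pole = "\<lambda>t. t ^ 3 = 1" and off = "\<lambda>_. 0"])
    fix t u assume t: "t \<in> U_set d" and u: "u \<in> U_set d"
    have t0: "t \<noteq> 0" using cube[OF t] by auto
    show "t = u" if "int (f (t\<^sup>2)) = int (f (u\<^sup>2))" "(t ^ 3 = 1) = (u ^ 3 = 1)"
    proof (rule determined[OF _ _ t0])
      show "t\<^sup>2 = u\<^sup>2" using f t u that(1) by (auto simp: inj_on_def)
      show "t ^ 3 = u ^ 3" using cube[OF t] cube[OF u] that(2) by auto
    qed
    assume eq: "1 + t * u\<^sup>2 = 0"
    \<comment> \<open>Multiply \<open>t * u^2 = -1\<close> by \<open>u^4\<close> and use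
      \<open>u^6 = 1\<close>. Then \<open>t^2 = u^8 = u^2\<close> and
      \<open>t^3 = -u^12 = -1\<close>.\<close>
    have tu: "t = - (u ^ 4)"
    proof -
      have "t * u\<^sup>2 = - 1" using eq by (simp add: eq_neg_iff_add_eq_0 add.commute)
      moreover have "u ^ 6 = u\<^sup>2 * u ^ 4" by (simp flip: power_add)
      ultimately have "t * u ^ 6 = - (u ^ 4)" by (metis mult.assoc mult_minus1)
      then show ?thesis using U_set_power_6[OF u assms] by simp
    qed
    have u12: "u ^ 12 = 1" and u8: "u ^ 8 = u\<^sup>2"
      using U_set_power_6[OF u assms] power_mult[of u 6 2] power_add[of u 6 2] by simp_all
    have "t\<^sup>2 = u\<^sup>2" using u8 by (simp add: tu flip: power_mult)
    moreover have t3: "t ^ 3 = -1" using u12 by (simp add: tu flip: power_mult)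
    \<comment> \<open>The cube of \<open>u\<close> is then -1 as well, so \<open>t\<close> and
      \<open>u\<close> agree in square and cube.\<close>
    moreover have "t = u" if "u ^ 3 \<noteq> 1"
      using determined calculation cube[OF u] that t0 by simp
    ultimately show "int (f (t\<^sup>2)) = int (f (u\<^sup>2)) \<and> \<not> (t ^ 3 = 1 \<and> u ^ 3 = 1) \<and>
        (\<not> t ^ 3 = 1 \<and> \<not> u ^ 3 = 1 \<longrightarrow> t = u)"
      by simp
  qed auto
qed

theorem theorem3p17:
  fixes d n :: nat
  assumes "d = 0 \<or> squarefree d" and "n \<ge> 1"
  shows "(planar (Gamma1 d n) \<longleftrightarrow> n = 1) \<and> (planar (Gamma2_un d n) \<longleftrightarrow> n = 1)"
proof (cases "n = 1")
  case True
  then show ?thesis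
    using planar_Gamma1_1 planar_Gamma2_un_1_gaussian planar_Gamma2_un_1_not_gaussian by metis
next
  case False
  then show ?thesis
    using assms(2) Gamma1_not_planar[of n d] Gamma2_un_not_planar[of n d] by simp
qed

end
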